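(* Asymptotically almost surely, the rankwidth of a graph drawn randomly from $G(n,\frac12)$ is bounded from below by $\Omega(n)$. That is, there exists a constant $c>0$ such that, for $G$ drawn from $G(n,\frac12)$, $$\lim_{n\to\infty}\Pr\big[\mathrm{rw}(G)\ge c\,n\big]=1 .$$
   Context: $G(n,\frac12)$ is the random simple graph on $n$ labelled vertices in which each of the $\binom n2$ possible edges appears independently with probability $\frac12$. Rankwidth. Let $G$ be a finite simple graph with vertex set $V$, $|V|\ge 2$. A decomposition tree of $G$ is a pair $(T,\delta)$ where $T$ is a tree in which every internal node has degree $3$ and $\delta$ is a bijection between the leaves of $T$ and $V$. Removing an edge $uv$ of $T$ leaves two subtrees; let $\{X_u,X_v\}$ be the 2-partition of $V$ induced by the leaf sets of these two subtrees. For a function $f$ on subsets of $V$ with $f(A)=f(V\setminus A)$ for all $A$ (a cut function), the $f$-width of $(T,\delta)$ is the maximum of $f(X_u)$ over all edges $uv$ of $T$, and the $f$-width of $G$ is the minimum $f$-width over all decomposition trees of $G$. For $A\subseteq V$ and $B=V\setminus A$, the cut-rank function is $$f_{\mathrm{rw}}(A)=\log_2\Big|\Big\{Y\subseteq B:\ \exists X\subseteq A,\ Y=\mathop{\triangle}_{x\in X}\big(N(x)\cap B\big)\Big\}\Big|,$$ where $N(x)$ is the set of vertices adjacent to $x$ and $\triangle$ denotes symmetric difference. Equivalently, $f_{\mathrm{rw}}(A)$ is the rank over $GF(2)$ of the $|A|\times|V\setminus A|$ submatrix of the adjacency matrix of $G$ with rows indexed by $A$ and columns indexed by $V\setminus A$.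 The rankwidth $\mathrm{rw}(G)$ is the $f_{\mathrm{rw}}$-width of $G$. *)

theory Defs
  imports
    "Graph_Theory.Digraph_Component"
    "HOL-Probability.Probability"
begin

text \<open>
  Finite simple graphs are represented as in \<^theory>\<open>Graph_Theory.Pair_Digraph\<close>: a \<^locale>\<open>pair_graph\<close> is
  a finite, symmetric, loop-free set of ordered pairs together with a finite vertex set, so that an
  edge \<open>uv\<close> is the pair of arcs \<open>(u, v)\<close>, \<open>(v, u)\<close>. Out-degree is then the usual degree.

  The predicate \<open>tree\<close> of \<^theory>\<open>Graph_Theory.Digraph_Component\<close> is not the undirected notion
  (it counts \<open>u, v, u\<close> as a cycle). In a \<^locale>\<open>pair_graph\<close> the undirected cycles are the directed
  ones of length at least 3.
\<close>

definition undirected_tree :: "'t pair_pre_digraph \<Rightarrow> bool" where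
  "undirected_tree T \<longleftrightarrow>
     pair_graph T \<and> Digraph_Component.connected (with_proj T) \<and>
     \<not> (\<exists>p. pre_digraph.cycle (with_proj T) p \<and> length p \<ge> 3)"

definition leaves :: "'t pair_pre_digraph \<Rightarrow> 't set" where
  "leaves T = {t \<in> pverts T. out_degree (with_proj T) t = 1}"

definition decomposition_tree ::
    "'a set \<Rightarrow> 't pair_pre_digraph \<Rightarrow> ('t \<Rightarrow> 'a) \<Rightarrow> bool" where
  "decomposition_tree V T \<delta> \<longleftrightarrow>
     undirected_tree T \<and>
     (\<forall>t \<in> pverts T - leaves T. out_degree (with_proj T) t = 3) \<and>
     bij_betw \<delta> (leaves T) V"

definition del_edge :: "'t pair_pre_digraph \<Rightarrow> 't \<Rightarrow> 't \<Rightarrow> 't pair_pre_digraph" where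
  "del_edge T u v = \<lparr> pverts = pverts T, parcs = parcs T - {(u, v), (v, u)} \<rparr>"

text \<open>The part \<open>X\<^sub>u\<close> of the bipartition induced by the tree edge \<open>uv\<close>; \<open>X\<^sub>v\<close> is \<open>edge_part T \<delta> v u\<close>.\<close>

definition edge_part :: "'t pair_pre_digraph \<Rightarrow> ('t \<Rightarrow> 'a) \<Rightarrow> 't \<Rightarrow> 't \<Rightarrow> 'a set" where
  "edge_part T \<delta> u v = \<delta> ` {t \<in> leaves T. u \<rightarrow>\<^sup>*\<^bsub>with_proj (del_edge T u v)\<^esub> t}"

text \<open>Both orientations of each edge occur in the maximum; for a cut function they agree.\<close>

definition tree_width ::
    "('a set \<Rightarrow> real) \<Rightarrow> 't pair_pre_digraph \<Rightarrow> ('t \<Rightarrow> 'a) \<Rightarrow> real" where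
  "tree_width f T \<delta> = Max ((\<lambda>(u, v). f (edge_part T \<delta> u v)) ` parcs T)"

text \<open>
  Trees are finite, so up to isomorphism all of them have nodes in \<^typ>\<open>nat\<close>. There are infinitely
  many such trees, but for \<^term>\<open>card V \<ge> 2\<close> every width lies in the finite set \<^term>\<open>f ` Pow V\<close>,
  so the minimum exists. For \<^term>\<open>card V < 2\<close> there is no decomposition tree and the value is
  meaningless.
\<close>

definition f_width :: "'a set \<Rightarrow> ('a set \<Rightarrow> real) \<Rightarrow> real" where
  "f_width V f =
     Min {tree_width f T \<delta> | (T :: nat pair_pre_digraph) \<delta>. decomposition_tree V T \<delta>}"

definition big_sym_diff :: "('a \<Rightarrow> 'b set) \<Rightarrow> 'a set \<Rightarrow> 'b set" where
  "big_sym_diff F X = Finite_Set.fold (\<lambda>x S. sym_diff (F x) S) {} X"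

definition neighbours :: "'a pair_pre_digraph \<Rightarrow> 'a \<Rightarrow> 'a set" where
  "neighbours G x = {y. (x, y) \<in> parcs G}"

definition cut_rank :: "'a pair_pre_digraph \<Rightarrow> 'a set \<Rightarrow> real" where
  "cut_rank G A =
     (let B = pverts G - A
      in log 2 (real (card {Y. Y \<subseteq> B \<and>
           (\<exists>X \<subseteq> A. Y = big_sym_diff (\<lambda>x. neighbours G x \<inter> B) X)})))"

definition rankwidth :: "'a pair_pre_digraph \<Rightarrow> real" where
  "rankwidth G = f_width (pverts G) (cut_rank G)"

definition gnp :: "nat \<Rightarrow> real \<Rightarrow> nat pair_pre_digraph pmf" where
  "gnp n p =
     map_pmf (\<lambda>edge. \<lparr> pverts = {..<n}, parcs = {(u, v). edge {u, v}} \<rparr>)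
       (Pi_pmf {e. e \<subseteq> {..<n} \<and> card e = 2} False (\<lambda>_. bernoulli_pmf p))"

lemma tree_width_in_image:
  assumes "decomposition_tree V T \<delta>" and "V \<noteq> {}"
  shows "tree_width f T \<delta> \<in> f ` Pow V"
proof -
  from assms(1) have "pair_graph T" and bij: "bij_betw \<delta> (leaves T) V"
    by (auto simp: decomposition_tree_def undirected_tree_def)
  then interpret pair_graph T by simp
  from bij \<open>V \<noteq> {}\<close> obtain t where "t \<in> leaves T"
    by (auto simp: bij_betw_def)
  then have "out_arcs (with_proj T) t \<noteq> {}"
    by (auto simp: leaves_def out_degree_def)
  then have "parcs T \<noteq> {}"
    by (auto simp: out_arcs_def)
  with pair_finite_arcs
  have "tree_width f T \<delta> \<in> (\<lambda>(u, v). f (edge_part T \<delta> u v)) ` parcs T"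
    unfolding tree_width_def by (intro Max_in) auto
  moreover have "edge_part T \<delta> u v \<subseteq> V" for u v
    using bij by (auto simp: edge_part_def bij_betw_def)
  ultimately show ?thesis by auto
qed

lemma finite_tree_widths:
  assumes "finite V" and "V \<noteq> {}"
  shows "finite {tree_width f T \<delta> | T \<delta>. decomposition_tree V T \<delta>}"
  by (rule finite_subset[of _ "f ` Pow V"]) (auto simp: assms tree_width_in_image)

lemma mem_big_sym_diff:
  assumes "finite X"
  shows "y \<in> big_sym_diff F X \<longleftrightarrow> odd (card {x \<in> X. y \<in> F x})"
proof -
  interpret comp_fun_commute "\<lambda>x S. sym_diff (F x) S"
    by standard (auto simp: fun_eq_iff)
  show ?thesis using assms
  proof (induction X)
    case empty
    then show ?case by (simp add: big_sym_diff_def)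
  next
    case (insert a X)
    have "{x \<in> insert a X. y \<in> F x} =
            (if y \<in> F a then insert a {x \<in> X. y \<in> F x} else {x \<in> X. y \<in> F x})"
      by auto
    with insert show ?case by (auto simp: big_sym_diff_def)
  qed
qed

lemma set_pmf_gnp:
  assumes "G \<in> set_pmf (gnp n p)"
  shows "pair_graph G" and "pverts G = {..<n}"
proof -
  have fin: "finite {e. e \<subseteq> {..<n} \<and> card e = 2}"
    by (rule finite_subset[of _ "Pow {..<n}"]) auto
  from assms obtain edge where G: "G = \<lparr> pverts = {..<n}, parcs = {(u, v). edge {u, v}} \<rparr>"
    and "edge \<in> set_pmf (Pi_pmf {e. e \<subseteq> {..<n} \<and> card e = 2} False (\<lambda>_. bernoulli_pmf p))"
    by (auto simp: gnp_def)
  with set_Pi_pmf_subset[OF fin, of False "\<lambda>_. bernoulli_pmf p"]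
  have edge: "e \<subseteq> {..<n} \<and> card e = 2" if "edge e" for e
    using that by blast
  have arcs: "u < n \<and> v < n \<and> u \<noteq> v" if "(u, v) \<in> parcs G" for u v
    using edge[of "{u, v}"] that by (auto simp: G card_insert_if split: if_splits)
  have "finite (parcs G)"
    by (rule finite_subset[of _ "{..<n} \<times> {..<n}"]) (auto dest: arcs)
  moreover have "sym (parcs G)"
    by (auto simp: G sym_def insert_commute)
  moreover have "pverts G = {..<n}"
    by (simp add: G)
  ultimately show "pair_graph G"
    using arcs by unfold_locales (force simp: symmetric_def)+
  show "pverts G = {..<n}" by (simp add: G)
qed

end

theory Submission
  imports Defs
begin

text \<open>
  The constant is \<open>c = 1/6\<close>. Two facts about different objects meet in a cut of balanced size.

  Every decomposition tree on \<open>n \<ge> 2\<close> leaves has an edge one of whose sides \<open>A\<close> carries between \<open>n/3\<close>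
  and \<open>2n/3\<close> of the leaves (\<open>exists_balanced_arc\<close>): a side that is minimal among those with at least
  \<open>n/3\<close> leaves splits, at its end of the edge, into at most two smaller sides, each of which has fewer
  than \<open>n/3\<close>. Hence a graph of rankwidth below \<open>r\<close> has a balanced vertex set \<open>A\<close> of cut-rank below
  \<open>r\<close> (\<open>low_rankwidth_imp_low_rank_cut\<close>). As rankwidth is a minimum over decomposition trees, this also
  needs that some decomposition tree exists; a binary heap is one (\<open>exists_decomposition_tree\<close>).

  In a random graph such an \<open>A\<close> is very unlikely (\<open>prob_low_rank_cut\<close>). If the rows indexed by \<open>A\<close> of
  the cut matrix have rank below \<open>n/6\<close>, then a set \<open>R \<subseteq> A\<close> of fewer than \<open>n/6\<close> rows spans all of them.
  For fixed \<open>A\<close> and \<open>R\<close> and for a fixed choice, for each \<open>x \<in> A - R\<close>, of the subset of \<open>R\<close> that sums to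
  row \<open>x\<close>, all pairs between \<open>A - R\<close> and \<open>B = V - A\<close> are determined by the remaining pairs, which has
  probability at most \<open>2\<close> to the power \<open>- |A - R| |B|\<close>. There are \<open>2\<close> to the power \<open>|A - R| |R|\<close> such
  choices, and both \<open>|A - R|\<close> and \<open>|B| - |R|\<close> are at least \<open>n/6\<close>; so the probability is at most \<open>2\<close> to
  the power \<open>- n\<^sup>2/36\<close>, up to rounding. This absorbs the at most \<open>4\<close> to the power \<open>n\<close> pairs \<open>(A, R)\<close>.
\<close>

section \<open>Bases of subset-sum spaces\<close>

lemma even_card_sym_diff:
  assumes "finite A" "finite B"
  shows "even (card (sym_diff A B)) \<longleftrightarrow> (even (card A) \<longleftrightarrow> even (card B))"
proof -
  have "card (sym_diff A B) = card (A - B) + card (B - A)"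
    using assms by (intro card_Un_disjoint) auto
  moreover have "card A = card (A - B) + card (A \<inter> B)"
    using assms by (subst card_Un_disjoint[symmetric]) (auto intro: arg_cong[where f = card])
  moreover have "card B = card (B - A) + card (A \<inter> B)"
    using assms by (subst card_Un_disjoint[symmetric]) (auto intro: arg_cong[where f = card])
  ultimately show ?thesis by auto
qed

text \<open>
  Subsets under symmetric difference form a vector space over the field with two elements, and taking
  the sum of a family of vectors over a set of indices is linear in that set.
\<close>

lemma big_sym_diff_sym_diff:
  assumes "finite X" "finite Y"
  shows "big_sym_diff F (sym_diff X Y) = sym_diff (big_sym_diff F X) (big_sym_diff F Y)"
proof -
  have "y \<in> big_sym_diff F (sym_diff X Y) \<longleftrightarrow> 
      y \<in> sym_diff (big_sym_diff F X) (big_sym_diff F Y)" for y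
  proof -
    have eq: "{x \<in> sym_diff X Y. y \<in> F x} = sym_diff {x \<in> X. y \<in> F x} {x \<in> Y. y \<in> F x}"
      by auto
    show ?thesis
      using assms even_card_sym_diff[of "{x \<in> X. y \<in> F x}" "{x \<in> Y. y \<in> F x}"]
      unfolding mem_big_sym_diff[OF finite_UnI[OF finite_Diff[OF assms(1)] finite_Diff[OF assms(2)]]] eq
      by (simp add: mem_big_sym_diff) blast
  qed
  then show ?thesis by blast
qed

lemma big_sym_diff_empty [simp]: "big_sym_diff F {} = {}"
  by (simp add: big_sym_diff_def)

lemma big_sym_diff_singleton [simp]: "big_sym_diff F {x} = F x"
  by (rule set_eqI) (simp add: mem_big_sym_diff Collect_conv_if)

text \<open>
  Existence of a basis among finitely many vectors. Injectivity on \<^term>\<open>Pow R\<close> is linear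
  independence of the vectors indexed by \<open>R\<close>: distinct subsets have distinct sums. A maximal independent
  \<open>R\<close> spans, because adding any further index creates a nontrivial relation that must involve it.
\<close>

lemma exists_independent_spanning_subset:
  assumes "finite A"
  shows "\<exists>R \<subseteq> A. inj_on (big_sym_diff F) (Pow R) \<and> (\<forall>x \<in> A. \<exists>X \<subseteq> R. F x = big_sym_diff F X)"
proof -
  let ?I = "{R. R \<subseteq> A \<and> inj_on (big_sym_diff F) (Pow R)}"
  have "finite ?I" using assms by auto
  moreover have "?I \<noteq> {}" by (auto intro: exI[of _ "{}"])
  ultimately obtain R where R: "R \<in> ?I" and max: "\<And>R'. R' \<in> ?I \<Longrightarrow> R \<subseteq> R' \<Longrightarrow> R = R'"
    using finite_has_maximal[of ?I] by auto
  have finR: "finite R" using R assms finite_subset by blast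
  have "\<exists>X \<subseteq> R. F x = big_sym_diff F X" if "x \<in> A" for x
  proof (cases "x \<in> R")
    case True
    then show ?thesis by (intro exI[of _ "{x}"]) auto
  next
    case False
    then have "\<not> inj_on (big_sym_diff F) (Pow (insert x R))"
      using max[of "insert x R"] R that by auto
    then obtain X Y where XY: "X \<subseteq> insert x R" "Y \<subseteq> insert x R" "X \<noteq> Y"
        "big_sym_diff F X = big_sym_diff F Y"
      unfolding inj_on_def by auto
    \<comment> \<open>By linearity the collision becomes a vanishing sum over a nonempty index set.\<close>
    define Z where "Z = sym_diff X Y"
    have fin: "finite X" "finite Y" using XY finR by (auto intro: finite_subset)
    then have Z: "Z \<subseteq> insert x R" "Z \<noteq> {}" "big_sym_diff F Z = {}" "finite Z"
      using XY by (auto simp: Z_def big_sym_diff_sym_diff)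
    have "x \<in> Z"
    proof (rule ccontr)
      assume "x \<notin> Z"
      then have "Z \<subseteq> R" using Z by auto
      then have "Z = {}" using R Z(3) by (auto simp: inj_on_def dest: bspec[where x = "{}"])
      with Z show False by simp
    qed
    define Z' where "Z' = Z - {x}"
    have "Z = sym_diff {x} Z'" using \<open>x \<in> Z\<close> by (auto simp: Z'_def)
    then have "{} = sym_diff (F x) (big_sym_diff F Z')"
      using Z(3,4) big_sym_diff_sym_diff[of "{x}" Z' F] by (simp add: Z'_def)
    then have "F x = big_sym_diff F Z'" by blast
    moreover have "Z' \<subseteq> R" using Z by (auto simp: Z'_def)
    ultimately show ?thesis by blast
  qed
  with R show ?thesis by blast
qed

text \<open>
  A basis \<open>R\<close> of the rows has \<open>2\<close> to the power \<open>|R|\<close> distinct subset sums, all of which are counted in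
  the row space whose size defines the cut-rank.
\<close>

lemma cut_rank_basis:
  assumes "finite (pverts G)" "A \<subseteq> pverts G"
  shows "\<exists>R \<subseteq> A. real (card R) \<le> cut_rank G A \<and>
    (\<forall>x \<in> A. \<exists>X \<subseteq> R. neighbours G x \<inter> (pverts G - A) =
        big_sym_diff (\<lambda>x. neighbours G x \<inter> (pverts G - A)) X)"
proof -
  define B where "B = pverts G - A"
  define F where "F = (\<lambda>x. neighbours G x \<inter> B)"
  have finA: "finite A" using assms finite_subset by blast
  obtain R where R: "R \<subseteq> A" and inj: "inj_on (big_sym_diff F) (Pow R)"
    and span: "\<forall>x \<in> A. \<exists>X \<subseteq> R. F x = big_sym_diff F X"
    using exists_independent_spanning_subset[OF finA] by metis
  define S where "S = {Y. Y \<subseteq> B \<and> (\<exists>X \<subseteq> A. Y = big_sym_diff F X)}"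
  have sub: "big_sym_diff F X \<subseteq> B" if "X \<subseteq> A" for X
  proof
    fix y assume "y \<in> big_sym_diff F X"
    then have "odd (card {x \<in> X. y \<in> F x})"
      using that finA by (auto simp: mem_big_sym_diff finite_subset)
    then have "{x \<in> X. y \<in> F x} \<noteq> {}" by (metis card.empty even_zero)
    then show "y \<in> B" by (auto simp: F_def)
  qed
  have "finite S"
    using assms by (auto simp: S_def B_def intro: finite_subset[of _ "Pow (pverts G)"])
  have "2 ^ card R = card (big_sym_diff F ` Pow R)"
    using inj R finA by (simp add: card_image card_Pow finite_subset)
  also have "\<dots> \<le> card S"
  proof (rule card_mono[OF \<open>finite S\<close>])
    have "big_sym_diff F X \<in> S" if "X \<subseteq> R" for X
      using sub[of X] that R unfolding S_def by blast
    then show "big_sym_diff F ` Pow R \<subseteq> S" by blast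
  qed
  finally have "real (card R) \<le> log 2 (real (card S))"
    by (rule le_log2_of_power)
  also have "\<dots> = cut_rank G A"
    by (simp add: cut_rank_def S_def B_def F_def Let_def)
  finally show ?thesis
    using R span unfolding F_def B_def by blast
qed

section \<open>Balanced cuts of low rank are unlikely\<close>

text \<open>
  The counting form of an independence argument: an event that fixes the coordinates in \<open>D\<close> as functions
  of the others has probability at most \<open>2\<close> to the power \<open>- |D|\<close>.
\<close>

lemma card_mult_pow_le_if_determined_outside:
  assumes "finite U" "D \<subseteq> U" "\<E> \<subseteq> Pow U" "inj_on (\<lambda>E. E - D) \<E>"
  shows "card \<E> * 2 ^ card D \<le> 2 ^ card U"
proof -
  have "card \<E> \<le> card (Pow (U - D))"
    using assms by (intro card_inj_on_le[of "\<lambda>E. E - D"]) auto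
  also have "\<dots> = 2 ^ (card U - card D)"
    using assms by (simp add: card_Pow card_Diff_subset finite_subset)
  finally have "card \<E> * 2 ^ card D \<le> 2 ^ (card U - card D) * 2 ^ card D" by simp
  also have "\<dots> = 2 ^ card U"
    using assms by (simp add: power_add[symmetric] card_mono)
  finally show ?thesis .
qed

definition edge_slots :: "nat \<Rightarrow> nat set set" where
  "edge_slots n = {e. e \<subseteq> {..<n} \<and> card e = 2}"

lemma finite_edge_slots [simp]: "finite (edge_slots n)"
  by (rule finite_subset[of _ "Pow {..<n}"]) (auto simp: edge_slots_def)

definition graph_of :: "nat \<Rightarrow> nat set set \<Rightarrow> nat pair_pre_digraph" where
  "graph_of n E = \<lparr> pverts = {..<n}, parcs = {(u, v). {u, v} \<in> E} \<rparr>"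

text \<open>
  For edge probability \<open>1/2\<close> all edge sets are equally likely, so probabilities become cardinalities.
\<close>

lemma gnp_half_eq: "gnp n (1 / 2) = map_pmf (graph_of n) (pmf_of_set (Pow (edge_slots n)))"
proof -
  let ?P = "Pi_pmf (edge_slots n) False (\<lambda>_. bernoulli_pmf (1 / 2))"
  have "gnp n (1 / 2) = map_pmf (\<lambda>edge. graph_of n {e \<in> edge_slots n. edge e}) ?P"
    unfolding gnp_def edge_slots_def[symmetric]
  proof (rule map_pmf_cong[OF refl])
    fix edge assume "edge \<in> set_pmf ?P"
    then have "edge \<in> {f. \<forall>e. e \<notin> edge_slots n \<longrightarrow> f e = False}"
      by (rule subsetD[OF set_Pi_pmf_subset[OF finite_edge_slots]])
    then have "edge e \<Longrightarrow> e \<in> edge_slots n" for e by blast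
    then show "\<lparr>pverts = {..<n}, parcs = {(u, v). edge {u, v}}\<rparr> =
        graph_of n {e \<in> edge_slots n. edge e}"
      by (auto simp: graph_of_def)
  qed
  also have "\<dots> = map_pmf (graph_of n) (pmf_of_set (Pow (edge_slots n)))"
    unfolding pmf_of_set_Pow_conv_bernoulli[OF finite_edge_slots, of _ False, symmetric]
    by (simp only: map_pmf_comp)
  finally show ?thesis .
qed

text \<open>
  The edge sets for which row \<open>x\<close> of the cut matrix of \<open>A\<close> is the sum over the field with two elements
  of the rows in \<open>g x\<close>, for each \<open>x\<close> in \<open>A - R\<close>.
\<close>

definition row_dependent :: "nat \<Rightarrow> nat set \<Rightarrow> nat set \<Rightarrow> (nat \<Rightarrow> nat set) \<Rightarrow> nat set set set" where
  "row_dependent n A R g = {E \<in> Pow (edge_slots n). \<forall>x \<in> A - R. \<forall>b \<in> {..<n} - A.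
     {x, b} \<in> E \<longleftrightarrow> odd (card {y \<in> g x. {y, b} \<in> E})}"

text \<open>
  The equations express each pair between \<open>A - R\<close> and the complement of \<open>A\<close> through pairs that have an
  end in \<open>R\<close>, so none of the expressed pairs occurs on a right-hand side.
\<close>

lemma card_row_dependent:
  assumes "A \<subseteq> {..<n}" "R \<subseteq> A" "\<And>x. x \<in> A - R \<Longrightarrow> g x \<subseteq> R"
  shows "card (row_dependent n A R g) * 2 ^ (card (A - R) * card ({..<n} - A)) \<le> 2 ^ card (edge_slots n)"
proof -
  define D where "D = (\<lambda>(x, b). {x, b}) ` ((A - R) \<times> ({..<n} - A))"
  have "inj_on (\<lambda>(x, b). {x, b}) ((A - R) \<times> ({..<n} - A))"
    by (auto simp: inj_on_def doubleton_eq_iff)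
  then have card_D: "card D = card (A - R) * card ({..<n} - A)"
    by (simp add: D_def card_image card_cartesian_product)
  have "inj_on (\<lambda>E. E - D) (row_dependent n A R g)"
  proof (rule inj_onI)
    fix E E' assume E: "E \<in> row_dependent n A R g" "E' \<in> row_dependent n A R g"
      and eq: "E - D = E' - D"
    have "{x, b} \<in> E \<longleftrightarrow> {x, b} \<in> E'" if "x \<in> A - R" "b \<in> {..<n} - A" for x b
    proof -
      have "{y, b} \<notin> D" if "y \<in> g x" for y
        using assms(2) assms(3)[OF \<open>x \<in> A - R\<close>] that \<open>b \<in> {..<n} - A\<close>
        by (auto simp: D_def doubleton_eq_iff)
      then have "{y \<in> g x. {y, b} \<in> E} = {y \<in> g x. {y, b} \<in> E'}"
        using eq by blast
      with E that show ?thesis by (simp add: row_dependent_def)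
    qed
    then have "E \<inter> D = E' \<inter> D" by (auto simp: D_def)
    with eq show "E = E'" by blast
  qed
  moreover have "D \<subseteq> edge_slots n"
    using assms by (auto simp: D_def edge_slots_def card_insert_if)
  ultimately show ?thesis
    using card_mult_pow_le_if_determined_outside[of "edge_slots n" D "row_dependent n A R g"]
    by (auto simp: card_D row_dependent_def)
qed

text \<open>
  The edge sets for which the rows in \<open>R\<close> span all rows of the cut matrix of \<open>A\<close>.
\<close>

definition spanned_by :: "nat \<Rightarrow> nat set \<Rightarrow> nat set \<Rightarrow> nat set set set" where
  "spanned_by n A R = {E \<in> Pow (edge_slots n). \<forall>x \<in> A - R. \<exists>X \<subseteq> R. \<forall>b \<in> {..<n} - A.
     {x, b} \<in> E \<longleftrightarrow> odd (card {y \<in> X. {y, b} \<in> E})}"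

text \<open>
  Union bound over the coefficients: each of the \<open>|A - R|\<close> rows has \<open>2\<close> to the power \<open>|R|\<close> possible
  coefficient sets, against a factor of \<open>2\<close> to the power \<open>|B|\<close> saved by \<open>card_row_dependent\<close>, where
  \<open>B\<close> is the complement of \<open>A\<close>. The net saving per row is at least \<open>2\<close> to the power \<open>k\<close>, and there are
  at least \<open>k\<close> rows.
\<close>

lemma card_spanned_by:
  assumes "A \<subseteq> {..<n}" "R \<subseteq> A" "k \<le> card (A - R)" "card R + k \<le> card ({..<n} - A)"
  shows "card (spanned_by n A R) * 2 ^ (k * k) \<le> 2 ^ card (edge_slots n)"
proof -
  let ?a = "card (A - R)" and ?b = "card ({..<n} - A)" and ?U = "edge_slots n"
  let ?\<G> = "PiE (A - R) (\<lambda>_. Pow R)"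
  have fin: "finite A" "finite R"
    using assms(1,2) by (auto intro: finite_subset[of _ "{..<n}"])
  have cover: "spanned_by n A R \<subseteq> (\<Union>g \<in> ?\<G>. row_dependent n A R g)"
  proof
    fix E assume E: "E \<in> spanned_by n A R"
    then have "\<forall>x \<in> A - R. \<exists>X. X \<subseteq> R \<and> (\<forall>b \<in> {..<n} - A.
        {x, b} \<in> E \<longleftrightarrow> odd (card {y \<in> X. {y, b} \<in> E}))"
      by (simp add: spanned_by_def)
    from bchoice[OF this] obtain g where g: "\<forall>x \<in> A - R. g x \<subseteq> R \<and> (\<forall>b \<in> {..<n} - A.
        {x, b} \<in> E \<longleftrightarrow> odd (card {y \<in> g x. {y, b} \<in> E}))" ..
    then have "E \<in> row_dependent n A R (restrict g (A - R))"
      using E by (auto simp: row_dependent_def spanned_by_def)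
    moreover have "restrict g (A - R) \<in> ?\<G>" using g by auto
    ultimately show "E \<in> (\<Union>g \<in> ?\<G>. row_dependent n A R g)" by blast
  qed
  have fin_dep: "finite (row_dependent n A R g)" for g
    by (rule finite_subset[of _ "Pow ?U"]) (auto simp: row_dependent_def)
  have fin_fun: "finite ?\<G>" using fin by (intro finite_PiE) auto
  have "card (spanned_by n A R) \<le> card (\<Union>g \<in> ?\<G>. row_dependent n A R g)"
    by (intro card_mono cover finite_UN_I fin_fun fin_dep)
  also have "\<dots> \<le> (\<Sum>g \<in> ?\<G>. card (row_dependent n A R g))"
    by (rule card_UN_le[OF fin_fun])
  finally have "card (spanned_by n A R) * 2 ^ (?a * ?b) \<le>
      (\<Sum>g \<in> ?\<G>. card (row_dependent n A R g)) * 2 ^ (?a * ?b)"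
    by (rule mult_right_mono) simp
  also have "\<dots> = (\<Sum>g \<in> ?\<G>. card (row_dependent n A R g) * 2 ^ (?a * ?b))"
    by (simp add: sum_distrib_right)
  also have "\<dots> \<le> (\<Sum>g \<in> ?\<G>. 2 ^ card ?U)"
    using assms by (intro sum_mono card_row_dependent) (auto simp: PiE_def Pi_def)
  also have "\<dots> = 2 ^ (card R * ?a) * 2 ^ card ?U"
    using fin by (simp add: card_PiE card_Pow power_mult[symmetric])
  finally have le: "card (spanned_by n A R) * 2 ^ (?a * ?b) \<le> 2 ^ (card R * ?a) * 2 ^ card ?U" .
  have "card R * ?a + k * k \<le> card R * ?a + ?a * k"
    using assms by simp
  also have "\<dots> = ?a * (card R + k)" by (simp add: algebra_simps)
  also have "\<dots> \<le> ?a * ?b" using assms by simp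
  finally have "(2::nat) ^ (card R * ?a + k * k) \<le> 2 ^ (?a * ?b)"
    by (rule power_increasing) simp
  then have "card (spanned_by n A R) * 2 ^ (card R * ?a + k * k) \<le> 2 ^ (card R * ?a) * 2 ^ card ?U"
    by (rule order_trans[OF mult_le_mono2 le])
  then show ?thesis by (simp add: power_add)
qed

lemma low_cut_rank_imp_spanned_by:
  assumes "E \<subseteq> edge_slots n" "A \<subseteq> {..<n}"
  shows "\<exists>R \<subseteq> A. real (card R) \<le> cut_rank (graph_of n E) A \<and> E \<in> spanned_by n A R"
proof -
  let ?G = "graph_of n E" and ?B = "{..<n} - A"
  have pv: "pverts ?G = {..<n}" by (simp add: graph_of_def)
  obtain R where R: "R \<subseteq> A" "real (card R) \<le> cut_rank ?G A"
    and span: "\<forall>x \<in> A. \<exists>X \<subseteq> R. neighbours ?G x \<inter> ?B =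
        big_sym_diff (\<lambda>x. neighbours ?G x \<inter> ?B) X"
    using cut_rank_basis[of ?G A] assms by (auto simp: pv)
  have "\<exists>X \<subseteq> R. \<forall>b \<in> ?B. {x, b} \<in> E \<longleftrightarrow> odd (card {y \<in> X. {y, b} \<in> E})" if x: "x \<in> A" for x
  proof -
    obtain X where X: "X \<subseteq> R" "neighbours ?G x \<inter> ?B = big_sym_diff (\<lambda>x. neighbours ?G x \<inter> ?B) X"
      using span x by blast
    have finX: "finite X"
      by (rule finite_subset[of _ "{..<n}"]) (use X(1) R(1) assms(2) in auto)
    have "{x, b} \<in> E \<longleftrightarrow> odd (card {y \<in> X. {y, b} \<in> E})" if "b \<in> ?B" for b
    proof -
      have "{x, b} \<in> E \<longleftrightarrow> b \<in> neighbours ?G x \<inter> ?B"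
        using that by (simp add: neighbours_def graph_of_def)
      also have "\<dots> \<longleftrightarrow> odd (card {y \<in> X. b \<in> neighbours ?G y \<inter> ?B})"
        unfolding X(2) using finX by (simp add: mem_big_sym_diff)
      also have "{y \<in> X. b \<in> neighbours ?G y \<inter> ?B} = {y \<in> X. {y, b} \<in> E}"
        using that by (auto simp: neighbours_def graph_of_def)
      finally show ?thesis .
    qed
    with X(1) show ?thesis by blast
  qed
  then have "E \<in> spanned_by n A R" using assms by (auto simp: spanned_by_def)
  with R show ?thesis by blast
qed

text \<open>
  Union bound over the pairs \<open>(A, R)\<close>. If \<open>|A|\<close> lies between \<open>n/3\<close> and \<open>2n/3\<close> and \<open>|R| < n/6\<close>, then
  \<open>|A - R|\<close> and \<open>n - |A| - |R|\<close> both exceed \<open>n/3 - n/6 = n/6\<close>, as \<open>card_spanned_by\<close> requires.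
\<close>

lemma prob_low_rank_cut:
  "measure_pmf.prob (gnp n (1 / 2))
     {G. \<exists>A \<subseteq> {..<n}. n \<le> 3 * card A \<and> 3 * card A \<le> 2 * n \<and> cut_rank G A < real n / 6}
   \<le> 4 ^ n / 2 ^ ((n div 6) * (n div 6))"
proof -
  let ?U = "edge_slots n" and ?k = "n div 6"
  let ?Bad = "{G. \<exists>A \<subseteq> {..<n}. n \<le> 3 * card A \<and> 3 * card A \<le> 2 * n \<and> cut_rank G A < real n / 6}"
  let ?I = "{(A, R). A \<subseteq> {..<n} \<and> R \<subseteq> A \<and> ?k \<le> card (A - R) \<and> card R + ?k \<le> card ({..<n} - A)}"
  have fin_I: "finite ?I"
    by (rule finite_subset[of _ "Pow {..<n} \<times> Pow {..<n}"]) auto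
  have "card ?I \<le> card (Pow {..<n} \<times> Pow {..<n})"
    by (intro card_mono) auto
  also have "\<dots> = 4 ^ n"
    by (simp add: card_cartesian_product card_Pow power_mult_distrib[symmetric])
  finally have card_I: "card ?I \<le> 4 ^ n" .
  have sub: "Pow ?U \<inter> graph_of n -` ?Bad \<subseteq> (\<Union>(A, R) \<in> ?I. spanned_by n A R)"
  proof
    fix E assume "E \<in> Pow ?U \<inter> graph_of n -` ?Bad"
    then obtain A where E: "E \<subseteq> ?U" and A: "A \<subseteq> {..<n}" "n \<le> 3 * card A" "3 * card A \<le> 2 * n"
      and rank: "cut_rank (graph_of n E) A < real n / 6" by auto
    obtain R where R: "R \<subseteq> A" "real (card R) \<le> cut_rank (graph_of n E) A" "E \<in> spanned_by n A R"
      using low_cut_rank_imp_spanned_by[OF E A(1)] by blast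
    have "6 * card R < n" using R(2) rank by linarith
    moreover have "card (A - R) = card A - card R"
      using R(1) A(1) by (intro card_Diff_subset finite_subset[of R "{..<n}"]) auto
    moreover have "card ({..<n} - A) = n - card A"
      using A(1) by (subst card_Diff_subset) (auto intro: finite_subset)
    ultimately have "(A, R) \<in> ?I" using A R(1) by auto
    with R(3) show "E \<in> (\<Union>(A, R) \<in> ?I. spanned_by n A R)" by blast
  qed
  have "finite (spanned_by n A R)" for A R
    by (rule finite_subset[of _ "Pow ?U"]) (auto simp: spanned_by_def)
  then have "card (Pow ?U \<inter> graph_of n -` ?Bad) \<le> card (\<Union>(A, R) \<in> ?I. spanned_by n A R)"
    using fin_I by (intro card_mono sub finite_UN_I) auto
  also have "\<dots> \<le> (\<Sum>(A, R) \<in> ?I. card (spanned_by n A R))"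
    using card_UN_le[OF fin_I, of "\<lambda>(A, R). spanned_by n A R"] by (simp add: case_prod_unfold)
  finally have "card (Pow ?U \<inter> graph_of n -` ?Bad) * 2 ^ (?k * ?k) \<le>
      (\<Sum>(A, R) \<in> ?I. card (spanned_by n A R)) * 2 ^ (?k * ?k)"
    by (rule mult_right_mono) simp
  also have "\<dots> = (\<Sum>(A, R) \<in> ?I. card (spanned_by n A R) * 2 ^ (?k * ?k))"
    by (simp add: sum_distrib_right case_prod_unfold)
  also have "\<dots> \<le> (\<Sum>(A, R) \<in> ?I. 2 ^ card ?U)"
    by (intro sum_mono) (auto intro: card_spanned_by)
  also have "\<dots> = card ?I * 2 ^ card ?U" by (simp add: case_prod_unfold)
  also have "\<dots> \<le> 4 ^ n * 2 ^ card ?U" using card_I by simp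
  finally have "real (card (Pow ?U \<inter> graph_of n -` ?Bad)) * 2 ^ (?k * ?k) \<le> 4 ^ n * 2 ^ card ?U"
    unfolding of_nat_le_iff[symmetric, where 'a = real] by simp
  then have "real (card (Pow ?U \<inter> graph_of n -` ?Bad)) / 2 ^ card ?U \<le> 4 ^ n / 2 ^ (?k * ?k)"
    by (simp add: field_simps)
  moreover have "measure_pmf.prob (gnp n (1 / 2)) ?Bad =
      real (card (Pow ?U \<inter> graph_of n -` ?Bad)) / 2 ^ card ?U"
    by (simp add: gnp_half_eq measure_pmf_of_set[OF Pow_not_empty] card_Pow vimage_def)
  ultimately show ?thesis by simp
qed

section \<open>Balanced edges of decomposition trees\<close>

definition side :: "'t rel \<Rightarrow> 't \<Rightarrow> 't \<Rightarrow> 't set" where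
  "side E u v = (E - {(u, v), (v, u)})\<^sup>* `` {u}"

lemma self_in_side [simp]: "u \<in> side E u v"
  by (simp add: side_def)

lemma side_step:
  assumes "t \<in> side E u v" "(t, t') \<in> E" "(t, t') \<noteq> (u, v)" "(t, t') \<noteq> (v, u)"
  shows "t' \<in> side E u v"
  using assms by (auto simp: side_def intro: rtrancl_into_rtrancl)

lemma side_induct [consumes 1, case_names base step]:
  assumes "t \<in> side E u v" and "P u"
    and "\<And>t t'. \<lbrakk>t \<in> side E u v; (t, t') \<in> E; (t, t') \<noteq> (u, v); (t, t') \<noteq> (v, u); P t\<rbrakk> \<Longrightarrow> P t'"
  shows "P t"
proof -
  from assms(1) have "(u, t) \<in> (E - {(u, v), (v, u)})\<^sup>*" by (simp add: side_def)
  then show ?thesis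
  proof (induction rule: rtrancl_induct)
    case base show ?case by (fact assms(2))
  next
    case (step t t')
    then show ?case by (intro assms(3)[of t t']) (auto simp: side_def)
  qed
qed

lemma sides_cover:
  assumes "(u, t) \<in> E\<^sup>*"
  shows "t \<in> side E u v \<union> side E v u"
  using assms
proof (induction rule: rtrancl_induct)
  case base show ?case by simp
next
  case (step t t')
  show ?case
  proof (cases "(t, t') = (u, v) \<or> (t, t') = (v, u)")
    case True
    then show ?thesis by auto
  next
    case False
    with step show ?thesis by (auto intro: side_step)
  qed
qed

text \<open>
  A walk that leaves \<open>u\<close> through a neighbour \<open>a\<close> stays on the side of \<open>a\<close> of the edge \<open>au\<close> until it
  returns to \<open>u\<close>.
\<close>

lemma side_decomp:
  "side E u v \<subseteq> insert u (\<Union>a \<in> {a. (u, a) \<in> E} - {v}. side E a u)"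
proof
  fix t assume "t \<in> side E u v"
  then show "t \<in> insert u (\<Union>a \<in> {a. (u, a) \<in> E} - {v}. side E a u)"
  proof (induction rule: side_induct)
    case base show ?case by simp
  next
    case (step t t')
    show ?case
    proof (cases "t = u")
      case True
      with step show ?thesis by (auto intro!: bexI[of _ t'])
    next
      case False
      with step.IH obtain a where a: "(u, a) \<in> E" "a \<noteq> v" "t \<in> side E a u" by auto
      show ?thesis
      proof (cases "(t, t') = (a, u)")
        case False
        with \<open>t \<noteq> u\<close> a step.hyps have "t' \<in> side E a u" by (auto intro: side_step)
        with a show ?thesis by auto
      qed simp
    qed
  qed
qed

text \<open>
  A walk on the side of \<open>a\<close> never meets \<open>u\<close>, hence it cannot use the edge \<open>uv\<close> either.
\<close>

lemma side_psubset:
  assumes "(u, a) \<in> E" "a \<noteq> v" "u \<noteq> v" "u \<notin> side E a u"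
  shows "side E a u \<subset> side E u v"
proof -
  have "t \<in> side E u v" if "t \<in> side E a u" for t
    using that
  proof (induction rule: side_induct)
    case base
    show ?case using assms by (auto intro!: side_step[OF self_in_side])
  next
    case (step t t')
    then have "t' \<in> side E a u" by (auto intro: side_step)
    with step assms show ?case by (auto intro!: side_step[of t E u v t'])
  qed
  with assms(4) show ?thesis using self_in_side[of u E v] by blast
qed

lemma reachable_del_edge_iff:
  assumes "pair_wf_digraph T" "u \<in> pverts T"
  shows "u \<rightarrow>\<^sup>*\<^bsub>with_proj (del_edge T u v)\<^esub> t \<longleftrightarrow> t \<in> side (parcs T) u v"
proof -
  interpret T: pair_wf_digraph T by fact
  interpret H: pair_wf_digraph "del_edge T u v"
    by unfold_locales (auto simp: del_edge_def dest: T.wellformed')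
  show ?thesis
    using H.reachable_conv'[of u t] assms(2) by (simp add: del_edge_def side_def)
qed

text \<open>
  Otherwise a path from \<open>u\<close> to \<open>v\<close> that avoids the edge, closed up by the edge, is a cycle; it has at
  least three arcs, as the path is neither empty nor the edge itself.
\<close>

lemma tree_edge_is_bridge:
  assumes "undirected_tree T" "(u, v) \<in> parcs T"
  shows "v \<notin> side (parcs T) u v"
proof
  assume v: "v \<in> side (parcs T) u v"
  from assms have "pair_graph T" by (simp add: undirected_tree_def)
  then interpret T: pair_graph T .
  have u: "u \<in> pverts T" using assms T.wellformed' by blast
  interpret H: pair_wf_digraph "del_edge T u v"
    by unfold_locales (auto simp: del_edge_def dest: T.wellformed')
  have "u \<rightarrow>\<^sup>*\<^bsub>with_proj (del_edge T u v)\<^esub> v"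
    using v reachable_del_edge_iff[OF T.pair_wf_digraph u] by simp
  then obtain p where "H.apath u p v" by (auto simp: H.reachable_apath)
  then have walk: "H.awalk u p v" and dist: "distinct (pawalk_verts u p)"
    by (auto simp: H.apath_def)
  have walk_T: "T.awalk u p v"
    using walk unfolding H.awalk_def T.awalk_def by (auto simp: del_edge_def)
  have "T.awalk u (p @ [(v, u)]) u"
    using walk_T assms(2) T.arcs_symmetric
    by (auto simp: T.awalk_simps u T.awalk_last_in_verts)
  moreover have "pawalk_verts u (p @ [(v, u)]) = pawalk_verts u p @ [u]"
    using T.awalk_verts_append[OF calculation] walk_T by simp
  moreover have "distinct (tl (pawalk_verts u p @ [u]))"
    using dist by (cases p) (use walk_T in \<open>auto simp: T.awalk_def\<close>)
  ultimately have "T.cycle (p @ [(v, u)])" unfolding T.cycle_def by auto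
  moreover have "length (p @ [(v, u)]) \<ge> 3"
  proof -
    have "u \<noteq> v" using assms(2) T.no_loops' by blast
    then have "p \<noteq> []" using walk by (auto simp: H.awalk_Nil_iff)
    moreover have "p \<noteq> [e]" for e
      using walk unfolding H.awalk_def by (cases e) (auto simp: del_edge_def)
    ultimately show ?thesis by (cases p; cases "tl p") auto
  qed
  ultimately show False using assms(1) by (auto simp: undirected_tree_def)
qed

lemma out_degree_eq_card_neighbours:
  "out_degree (with_proj T) t = card {a. (t, a) \<in> parcs T}"
proof -
  have "out_arcs (with_proj T) t = Pair t ` {a. (t, a) \<in> parcs T}"
    by (auto simp: out_arcs_def)
  then show ?thesis by (simp add: out_degree_def card_image inj_on_def)
qed

text \<open>
  Among the arcs \<open>(u, v)\<close> whose side at \<open>u\<close> carries at least a third of the leaves, take one whose side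
  has the fewest nodes. The sides beyond the other two neighbours of \<open>u\<close> have fewer nodes, hence each
  carries less than a third of the leaves, and together they carry all leaves of the side of \<open>u\<close>. If \<open>u\<close>
  is itself a leaf, its side is just \<open>{u}\<close>, and one leaf is at most two thirds of \<open>card V \<ge> 2\<close>.
\<close>

lemma exists_balanced_arc:
  assumes dec: "decomposition_tree V T \<delta>" and "card V \<ge> 2"
  shows "\<exists>(u, v) \<in> parcs T. card V \<le> 3 * card (edge_part T \<delta> u v) \<and>
    3 * card (edge_part T \<delta> u v) \<le> 2 * card V"
proof -
  let ?E = "parcs T" and ?L = "leaves T" and ?n = "card V"
  from dec have tree: "undirected_tree T" and bij: "bij_betw \<delta> ?L V"
    and deg3: "\<And>t. t \<in> pverts T - ?L \<Longrightarrow> card {a. (t, a) \<in> ?E} = 3"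
    by (auto simp: decomposition_tree_def out_degree_eq_card_neighbours)
  have deg1: "\<And>t. t \<in> ?L \<Longrightarrow> card {a. (t, a) \<in> ?E} = 1"
    by (simp add: leaves_def out_degree_eq_card_neighbours)
  from tree have "pair_graph T" and conn: "Digraph_Component.connected (with_proj T)"
    by (auto simp: undirected_tree_def)
  then interpret T: pair_graph T by simp
  have reach: "(s, t) \<in> ?E\<^sup>*" if "s \<in> pverts T" "t \<in> pverts T" for s t
    using conn that T.reachable_mk_symmetric_eq[OF T.sym_arcs]
    by (auto simp: connected_def strongly_connected_def T.reachable_conv)
  have LV: "?L \<subseteq> pverts T" by (auto simp: leaves_def)
  then have fin_L: "finite ?L" using T.pair_finite_verts finite_subset by blast
  have card_L: "card ?L = ?n" using bij by (rule bij_betw_same_card)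
  define w where "w u v = card (?L \<inter> side ?E u v)" for u v
  have part: "card (edge_part T \<delta> u v) = w u v" if "(u, v) \<in> ?E" for u v
  proof -
    have "u \<in> pverts T" using that T.wellformed' by blast
    then have "edge_part T \<delta> u v = \<delta> ` (?L \<inter> side ?E u v)"
      unfolding edge_part_def
      by (auto simp: reachable_del_edge_iff[OF T.pair_wf_digraph])
    moreover have "inj_on \<delta> (?L \<inter> side ?E u v)"
      using bij by (auto simp: bij_betw_def intro: inj_on_subset)
    ultimately show ?thesis by (simp add: card_image w_def)
  qed
  have fin_side: "finite (side ?E u v)" if "(u, v) \<in> ?E" for u v
  proof (rule finite_subset)
    show "side ?E u v \<subseteq> insert u (pverts T)"
    proof
      fix t assume "t \<in> side ?E u v"
      then show "t \<in> insert u (pverts T)"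
        by (induction rule: side_induct) (auto dest: T.wellformed')
    qed
  qed (simp add: T.pair_finite_verts)
  \<comment> \<open>Of the two sides of any edge, one carries at least half of the leaves.\<close>
  have heavy: "\<exists>(u, v) \<in> ?E. ?n \<le> 3 * w u v"
  proof -
    have "?L \<noteq> {}" using card_L \<open>?n \<ge> 2\<close> by auto
    then obtain l where l: "l \<in> ?L" by blast
    then have "{a. (l, a) \<in> ?E} \<noteq> {}" using deg1[OF l] by (metis card.empty zero_neq_one)
    then obtain m where m: "(l, m) \<in> ?E" by blast
    have "?L \<subseteq> (?L \<inter> side ?E l m) \<union> (?L \<inter> side ?E m l)"
      using sides_cover[of l _ ?E m] reach l LV by blast
    then have "?n \<le> card ((?L \<inter> side ?E l m) \<union> (?L \<inter> side ?E m l))"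
      unfolding card_L[symmetric] using fin_L by (intro card_mono) auto
    also have "\<dots> \<le> w l m + w m l"
      unfolding w_def by (rule card_Un_le)
    finally have "?n \<le> 3 * w l m \<or> ?n \<le> 3 * w m l" by linarith
    then show ?thesis
      using m T.arcs_symmetric[OF m]
      by (elim disjE) (auto intro: bexI[of _ "(l, m)"] bexI[of _ "(m, l)"])
  qed
  let ?P = "\<lambda>(u, v). (u, v) \<in> ?E \<and> ?n \<le> 3 * w u v"
  obtain e0 where "?P e0" using heavy by auto
  then obtain e where e: "?P e"
    and min: "\<And>e'. ?P e' \<Longrightarrow> (case e of (u, v) \<Rightarrow> card (side ?E u v)) \<le> (case e' of (u, v) \<Rightarrow> card (side ?E u v))"
    using ex_has_least_nat[of ?P e0 "\<lambda>(u, v). card (side ?E u v)"] by blast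
  obtain u v where uv: "e = (u, v)" by (cases e)
  have arc: "(u, v) \<in> ?E" and big: "?n \<le> 3 * w u v" using e uv by auto
  have u: "u \<in> pverts T" using arc T.wellformed' by blast
  have small: "3 * w a u < ?n" if "(u, a) \<in> ?E" "a \<noteq> v" for a
  proof (rule ccontr)
    assume "\<not> 3 * w a u < ?n"
    moreover have au: "(a, u) \<in> ?E" using that T.arcs_symmetric by blast
    ultimately have "card (side ?E u v) \<le> card (side ?E a u)"
      using min[of "(a, u)"] uv by auto
    moreover have "u \<noteq> v" using arc T.no_loops' by blast
    then have "side ?E a u \<subset> side ?E u v"
      using that tree_edge_is_bridge[OF tree au] by (intro side_psubset)
    then have "card (side ?E a u) < card (side ?E u v)"
      using fin_side[OF arc] by (rule psubset_card_mono[rotated])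
    ultimately show False by simp
  qed
  have "3 * w u v \<le> 2 * ?n"
  proof (cases "u \<in> ?L")
    case True
    then obtain x where "{a. (u, a) \<in> ?E} = {x}" using deg1 card_1_singletonE by metis
    then have "{a. (u, a) \<in> ?E} - {v} = {}" using arc by auto
    then have "side ?E u v \<subseteq> {u}" using side_decomp[of ?E u v] by (simp only: UN_empty)
    then have "w u v \<le> card {u}" unfolding w_def by (intro card_mono) auto
    then show ?thesis using \<open>?n \<ge> 2\<close> by simp
  next
    case False
    then have "card {a. (u, a) \<in> ?E} = 3" using deg3 u by blast
    then have "card ({a. (u, a) \<in> ?E} - {v}) = 2"
      using arc by (subst card_Diff_singleton) auto
    then obtain a b where ab: "{a. (u, a) \<in> ?E} - {v} = {a, b}"
      by (auto simp: card_2_iff)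
    then have "?L \<inter> side ?E u v \<subseteq> (?L \<inter> side ?E a u) \<union> (?L \<inter> side ?E b u)"
      using side_decomp[of ?E u v] False by auto
    then have "w u v \<le> card ((?L \<inter> side ?E a u) \<union> (?L \<inter> side ?E b u))"
      unfolding w_def using fin_L by (intro card_mono) auto
    also have "\<dots> \<le> w a u + w b u"
      unfolding w_def by (rule card_Un_le)
    finally have "w u v \<le> w a u + w b u" .
    moreover have "3 * w a u < ?n" "3 * w b u < ?n" using ab by (auto intro!: small)
    ultimately show ?thesis by linarith
  qed
  with arc big part[OF arc] show ?thesis by (intro bexI[of _ "(u, v)"]) auto
qed

section \<open>Existence of decomposition trees\<close>

text \<open>
  The binary heap, with node \<open>t \<ge> 1\<close> attached to \<open>t div 2\<close>. The top \<open>1\<close> of the usual heap would have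
  degree \<open>2\<close>; here it also has the parent \<open>0\<close>, which becomes a leaf. On \<open>2n - 2\<close> nodes the other leaves
  are \<open>n - 1, \<dots>, 2n - 3\<close>.
\<close>

definition heap_arcs :: "nat \<Rightarrow> nat rel" where
  "heap_arcs N = {(s, t). s < N \<and> t < N \<and> (1 \<le> s \<and> t = s div 2 \<or> 1 \<le> t \<and> s = t div 2)}"

definition heap_tree :: "nat \<Rightarrow> nat pair_pre_digraph" where
  "heap_tree N = \<lparr> pverts = {..<N}, parcs = heap_arcs N \<rparr>"

lemma heap_tree_simps [simp]:
  "pverts (heap_tree N) = {..<N}" "parcs (heap_tree N) = heap_arcs N"
  by (simp_all add: heap_tree_def)

lemma pair_graph_heap_tree: "pair_graph (heap_tree N)"
proof -
  have "finite (heap_arcs N)"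
    by (rule finite_subset[of _ "{..<N} \<times> {..<N}"]) (auto simp: heap_arcs_def)
  moreover have "sym (heap_arcs N)"
    by (auto simp: heap_arcs_def sym_def)
  ultimately show ?thesis
    by unfold_locales (auto simp: heap_arcs_def symmetric_def)
qed

lemma connected_heap_tree:
  assumes "N > 0"
  shows "Digraph_Component.connected (with_proj (heap_tree N))"
proof -
  interpret T: pair_graph "heap_tree N" by (rule pair_graph_heap_tree)
  have root: "t \<rightarrow>\<^sup>*\<^bsub>with_proj (heap_tree N)\<^esub> 0" if "t < N" for t
    using that
  proof (induction t rule: less_induct)
    case (less t)
    show ?case
    proof (cases "t = 0")
      case True
      then show ?thesis using assms by simp
    next
      case False
      then have "(t, t div 2) \<in> parcs (heap_tree N)"
        using less.prems by (auto simp: heap_arcs_def)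
      moreover have "(t div 2) \<rightarrow>\<^sup>*\<^bsub>with_proj (heap_tree N)\<^esub> 0"
        using False less by simp
      ultimately show ?thesis by (rule T.adj_reachable_trans)
    qed
  qed
  have "s \<rightarrow>\<^sup>*\<^bsub>with_proj (heap_tree N)\<^esub> t" if "s < N" "t < N" for s t
    using T.reachable_trans[OF root T.symmetric_reachable'[OF root]] that by blast
  then show ?thesis
    using assms T.reachable_mk_symmetric_eq[OF T.sym_arcs]
    by (auto simp: connected_def strongly_connected_def)
qed

text \<open>
  The largest node of a cycle is adjacent only to smaller nodes on the cycle, so both of its neighbours
  there are its parent. On a cycle with at least three arcs these neighbours are distinct.
\<close>

lemma no_long_cycle_heap_tree:
  assumes "pre_digraph.cycle (with_proj (heap_tree N)) p"
  shows "length p < 3"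
proof (rule ccontr)
  assume "\<not> length p < 3"
  then have len: "length p \<ge> 3" by simp
  interpret T: pair_graph "heap_tree N" by (rule pair_graph_heap_tree)
  obtain u where walk: "T.awalk u p u" and dist: "distinct (tl (pawalk_verts u p))"
    using assms by (auto simp: T.cycle_def)
  define k where "k = length p"
  define f where "f i = snd (p ! i)" for i
  have k: "k \<ge> 3" using len by (simp add: k_def)
  have cas: "pcas u p u" and arcs: "set p \<subseteq> heap_arcs N"
    using walk by (auto simp: T.awalk_def)
  have "pawalk_verts u p = fst (hd p) # map snd p"
    using T.awalk_verts_conv'[of u p u] cas len by auto
  then have inj: "f i \<noteq> f j" if "i < k" "j < k" "i \<noteq> j" for i j
    using dist that nth_eq_iff_index_eq[of "map snd p" i j] by (simp add: f_def k_def)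
  have chain: "pcas a q b \<Longrightarrow> Suc i < length q \<Longrightarrow> fst (q ! Suc i) = snd (q ! i)" for a q b i
  proof (induction q arbitrary: a i)
    case (Cons e q)
    then show ?case by (cases i; cases q) auto
  qed simp
  have ends: "pcas a q b \<Longrightarrow> q \<noteq> [] \<Longrightarrow> fst (q ! 0) = a \<and> snd (q ! (length q - 1)) = b" for a q b
  proof (induction q arbitrary: a)
    case (Cons e q)
    then show ?case by (cases q) auto
  qed simp
  \<comment> \<open>The heads \<open>f 0, \<dots>, f (k - 1)\<close> list the nodes of the cycle once; positions are taken cyclically.\<close>
  define pre where "pre i = (if i = 0 then k - 1 else i - 1)" for i
  have step: "(f (pre i), f i) \<in> heap_arcs N" if "i < k" for i
  proof -
    have "fst (p ! i) = f (pre i)"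
    proof (cases i)
      case 0
      then show ?thesis using ends[OF cas] k by (cases p) (auto simp: pre_def f_def k_def)
    next
      case (Suc j)
      then show ?thesis using chain[OF cas, of j] that by (simp add: pre_def f_def k_def)
    qed
    moreover have "p ! i \<in> heap_arcs N" using that arcs by (auto simp: k_def)
    ultimately show ?thesis by (metis f_def prod.collapse)
  qed
  obtain m where m: "m < k" and max: "\<And>i. i < k \<Longrightarrow> f i \<le> f m"
  proof -
    have "Max (f ` {..<k}) \<in> f ` {..<k}" using k by (intro Max_in) (auto simp: lessThan_empty_iff)
    then obtain m where "m < k" "f m = Max (f ` {..<k})" by auto
    then show ?thesis by (intro that[of m]) auto
  qed
  define nxt where "nxt = (if Suc m = k then 0 else Suc m)"
  have nxt: "nxt < k" "pre nxt = m" using m k by (auto simp: nxt_def pre_def)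
  have pre: "pre m < k" using m k by (auto simp: pre_def)
  have ne: "pre m \<noteq> nxt" using m k by (auto simp: nxt_def pre_def)
  have parent: "s = f m div 2" if "(s, f m) \<in> heap_arcs N \<or> (f m, s) \<in> heap_arcs N" "s \<le> f m" for s
    using that by (auto simp: heap_arcs_def)
  have "f (pre m) = f m div 2" using step[OF m] max[OF pre] by (intro parent) auto
  moreover have "f nxt = f m div 2" using step[OF nxt(1)] max[OF nxt(1)] nxt(2) by (intro parent) auto
  ultimately show False using inj[OF pre nxt(1) ne] by simp
qed

lemma heap_neighbours:
  assumes "n \<ge> 2" "t < 2 * n - 2"
  shows "{a. (t, a) \<in> heap_arcs (2 * n - 2)} =
    (if t = 0 then {1} else if t < n - 1 then {t div 2, 2 * t, 2 * t + 1} else {t div 2})"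
proof -
  have "(t, a) \<in> heap_arcs (2 * n - 2) \<longleftrightarrow>
      a \<in> (if t = 0 then {1} else if t < n - 1 then {t div 2, 2 * t, 2 * t + 1} else {t div 2})" for a
  proof -
    have children: "t = a div 2 \<longleftrightarrow> a = 2 * t \<or> a = 2 * t + 1" by presburger
    have "(t, a) \<in> heap_arcs (2 * n - 2) \<longleftrightarrow> a < 2 * n - 2 \<and>
        (1 \<le> t \<and> a = t div 2 \<or> 1 \<le> a \<and> (a = 2 * t \<or> a = 2 * t + 1))"
      using assms by (auto simp: heap_arcs_def children)
    then show ?thesis using assms by (auto split: if_splits)
  qed
  then show ?thesis by blast
qed

lemma exists_decomposition_tree:
  assumes "finite V" "card V \<ge> 2"
  shows "\<exists>(T :: nat pair_pre_digraph) \<delta>. decomposition_tree V T \<delta>"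
proof -
  define n where "n = card V"
  define T where "T = heap_tree (2 * n - 2)"
  have n: "n \<ge> 2" using assms by (simp add: n_def)
  have deg: "out_degree (with_proj T) t = (if 1 \<le> t \<and> t < n - 1 then 3 else 1)" if "t \<in> pverts T" for t
  proof -
    have "t < 2 * n - 2" using that by (simp add: T_def)
    moreover have "card {t div 2, 2 * t, 2 * t + 1} = 3" if "1 \<le> t"
    proof -
      have "t div 2 < 2 * t" using that by linarith
      then show ?thesis by (simp add: card_insert_if)
    qed
    ultimately show ?thesis
      using heap_neighbours[OF n] by (simp add: out_degree_eq_card_neighbours T_def)
  qed
  have "leaves T = insert 0 {n - 1..<2 * n - 2}"
  proof -
    have "t \<in> leaves T \<longleftrightarrow> t \<in> insert 0 {n - 1..<2 * n - 2}" for t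
    proof -
      have "t \<in> leaves T \<longleftrightarrow> t < 2 * n - 2 \<and> \<not> (1 \<le> t \<and> t < n - 1)"
        using deg[of t] by (cases "t < 2 * n - 2") (auto simp: leaves_def T_def)
      also have "\<dots> \<longleftrightarrow> t \<in> insert 0 {n - 1..<2 * n - 2}"
        using n by auto
      finally show ?thesis .
    qed
    then show ?thesis by blast
  qed
  then have "finite (leaves T) \<and> card (leaves T) = card V"
    using n unfolding n_def[symmetric] by simp
  then obtain \<delta> where "bij_betw \<delta> (leaves T) V"
    using assms by (metis finite_same_card_bij)
  moreover have "undirected_tree T"
    unfolding undirected_tree_def T_def
    using pair_graph_heap_tree connected_heap_tree[of "2 * n - 2"] n
    by (auto dest!: no_long_cycle_heap_tree)
  moreover have "\<forall>t \<in> pverts T - leaves T. out_degree (with_proj T) t = 3"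
    using deg by (auto simp: leaves_def)
  ultimately show ?thesis by (auto simp: decomposition_tree_def)
qed

section \<open>Rankwidth of random graphs\<close>

text \<open>
  The rankwidth is the width of an actual tree, since the set of widths is finite and nonempty; a
  balanced edge of that tree gives the cut.
\<close>

lemma low_rankwidth_imp_low_rank_cut:
  assumes "finite (pverts G)" "card (pverts G) \<ge> 2" "rankwidth G < r"
  shows "\<exists>A \<subseteq> pverts G. card (pverts G) \<le> 3 * card A \<and> 3 * card A \<le> 2 * card (pverts G) \<and>
    cut_rank G A < r"
proof -
  let ?V = "pverts G"
  let ?W = "{tree_width (cut_rank G) T \<delta> | (T :: nat pair_pre_digraph) \<delta>. decomposition_tree ?V T \<delta>}"
  have "?V \<noteq> {}" using assms(2) by auto
  then have "finite ?W" using assms(1) by (intro finite_tree_widths)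
  moreover have "?W \<noteq> {}" using exists_decomposition_tree[OF assms(1,2)] by blast
  ultimately have "rankwidth G \<in> ?W" unfolding rankwidth_def f_width_def by (rule Min_in)
  then obtain T :: "nat pair_pre_digraph" and \<delta> where dec: "decomposition_tree ?V T \<delta>"
    and width: "rankwidth G = tree_width (cut_rank G) T \<delta>" by blast
  obtain u v where uv: "(u, v) \<in> parcs T" "card ?V \<le> 3 * card (edge_part T \<delta> u v)"
      "3 * card (edge_part T \<delta> u v) \<le> 2 * card ?V"
    using exists_balanced_arc[OF dec assms(2)] by blast
  from dec have "pair_graph T" and bij: "bij_betw \<delta> (leaves T) ?V"
    by (auto simp: decomposition_tree_def undirected_tree_def)
  then interpret T: pair_graph T by simp
  have "cut_rank G (edge_part T \<delta> u v) \<le> tree_width (cut_rank G) T \<delta>"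
    unfolding tree_width_def using uv(1) T.pair_finite_arcs by (intro Max_ge) auto
  also have "\<dots> < r" using assms(3) width by simp
  finally have "cut_rank G (edge_part T \<delta> u v) < r" .
  moreover have "edge_part T \<delta> u v \<subseteq> ?V"
    using bij by (auto simp: edge_part_def bij_betw_def)
  ultimately show ?thesis using uv by blast
qed

text \<open>
  The bound \<open>114 = 6 * 19\<close> makes \<open>k = n div 6\<close> at least \<open>19\<close>. Then \<open>k\<^sup>2 \<ge> 19 k \<ge> 18 k + 15 \<ge> 3 n\<close>,
  which leaves a factor \<open>2\<close> to the power \<open>- n\<close> after the \<open>4\<close> to the power \<open>n\<close> pairs are absorbed.
\<close>

lemma prob_high_rankwidth:
  assumes "n \<ge> 114"
  shows "1 - (1 / 2) ^ n \<le> measure_pmf.prob (gnp n (1 / 2)) {G. rankwidth G \<ge> 1 / 6 * real n}"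
proof -
  let ?M = "gnp n (1 / 2)" and ?good = "{G :: nat pair_pre_digraph. rankwidth G \<ge> 1 / 6 * real n}"
  let ?cut = "{G. \<exists>A \<subseteq> {..<n}. n \<le> 3 * card A \<and> 3 * card A \<le> 2 * n \<and> cut_rank G A < real n / 6}"
  define k where "k = n div 6"
  have "n \<le> 6 * k + 5" "19 \<le> k" using assms unfolding k_def by linarith+
  then have "3 * n \<le> 19 * k" by linarith
  also have "\<dots> \<le> k * k" using \<open>19 \<le> k\<close> by (intro mult_right_mono) auto
  finally have exponent: "3 * n \<le> k * k" .
  have "G \<in> ?cut" if "G \<in> set_pmf ?M" "G \<in> - ?good" for G
    using low_rankwidth_imp_low_rank_cut[of G "real n / 6"] set_pmf_gnp[OF that(1)] that(2) assms
    by auto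
  then have "measure_pmf.prob ?M (- ?good) \<le> measure_pmf.prob ?M ?cut"
    by (intro measure_pmf.finite_measure_mono_AE) (auto simp: AE_measure_pmf_iff)
  also have "\<dots> \<le> 4 ^ n / 2 ^ (k * k)"
    unfolding k_def by (rule prob_low_rank_cut)
  also have "\<dots> \<le> 4 ^ n / 2 ^ (3 * n)"
    using exponent by (intro divide_left_mono power_increasing) auto
  also have "\<dots> = (1 / 2) ^ n"
    by (simp add: power_mult power_divide[symmetric])
  finally have "measure_pmf.prob ?M (- ?good) \<le> (1 / 2) ^ n" .
  then show ?thesis
    using measure_pmf.prob_compl[of ?good ?M] by (simp add: Compl_eq_Diff_UNIV)
qed

theorem theorem2:
  shows "\<exists>c::real. c > 0 \<and>
    (\<lambda>n. measure_pmf.prob (gnp n (1 / 2)) {G. rankwidth G \<ge> c * real n}) \<longlonglongrightarrow> 1"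
proof (intro exI conjI)
  show "(\<lambda>n. measure_pmf.prob (gnp n (1 / 2)) {G. rankwidth G \<ge> 1 / 6 * real n}) \<longlonglongrightarrow> 1"
  proof (rule tendsto_sandwich)
    show "\<forall>\<^sub>F n in sequentially. 1 - (1 / 2) ^ n \<le>
        measure_pmf.prob (gnp n (1 / 2)) {G. rankwidth G \<ge> 1 / 6 * real n}"
      by (rule eventually_sequentiallyI[of 114]) (rule prob_high_rankwidth)
    show "\<forall>\<^sub>F n in sequentially.
        measure_pmf.prob (gnp n (1 / 2)) {G. rankwidth G \<ge> 1 / 6 * real n} \<le> 1"
      by simp
    have "(\<lambda>n. 1 - (1 / 2) ^ n) \<longlonglongrightarrow> (1 - 0 :: real)"
      by (intro tendsto_diff tendsto_const LIMSEQ_power_zero) simp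
    then show "(\<lambda>n. 1 - (1 / 2) ^ n :: real) \<longlonglongrightarrow> 1" by simp
  qed simp
qed simp

end
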